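(* Let $n \ge 1$, let $B \subset \mathbb{R}^{n+1}$ be a compact strictly-convex set with non-empty interior, and let $S = \partial B$. Let $\{v_1, \dots, v_{n+1}\}$ be an orthonormal basis of $\mathbb{R}^{n+1}$ such that $B$ is regular with respect to this basis and has no special corners with respect to this basis. Then: (1) if $I$ is a subset of $\{1, \dots, n+1\}$ of size $k \le n$, then $\bigcap_{i \in I} D_i^0$ is homeomorphic to $S^{n-k}$; (2) for each $j \in \{1, \dots, n+1\}$, $\bigcap_{i \ne j} D_i^0$ consists of a pair of (distinct) points $x^{+}, x^{-}$ such that $x^{+} \in D_j^{+}$ and $x^{-} \in D_j^{-}$; (3) $\bigcap_{i=1}^{n+1} D_i^0$ is empty.
   Context: A subset $B \subset \mathbb{R}^{n+1}$ is strictly-convex if for all $x, y \in B$ every point of the straight line segment from $x$ to $y$, except possibly $x$ and $y$ themselves, lies in the interior of $B$. For a basis vector $v_i$, $p_i$ denotes the orthogonal projection of $\mathbb{R}^{n+1}$ onto the hyperplane $v_i^{\perp} \cong \mathbb{R}^n$. For non-empty $I \subset \{1, \dots, n+1\}$ with $k = |I| \le n$, $p_I$ is the composition of the (commuting) projections $p_i$, $i \in I$, i.e. the orthogonal projection onto $\{v_i : i \in I\}^{\perp} \cong \mathbb{R}^{n+1-k}$. Interiors and boundaries of $p_i(B)$ and $p_I(B)$ are taken inside $v_i^\perp$ and $\{v_i : i \in I\}^\perp$ respectively. $D_i^0 = \{x \in B : p_i(x) \in \partial p_i(B)\}$, which is a subset of $S$. (For $I = \emptyset$ the intersection is taken inside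 $S$, i.e. equals $S$.) For each $x$ in the interior of $p_i(B)$ there are exactly two points of $S$ projecting to $x$ under $p_i$; $x^+$ denotes the one with larger value of $u \mapsto u \cdot v_i$ and $x^-$ the one with smaller value. $U_i^{\pm}= \{x^{\pm} : x \in \operatorname{Int} p_i(B)\}$ and $D_i^{\pm} = D_i^0 \cup U_i^{\pm}$. $B$ is regular with respect to the basis if there is no non-empty $I \subset \{1, \dots, n+1\}$ with $|I| \le n$ and no point $x \in B$ such that $p_i(x) \in \partial p_i(B)$ for all $i \in I$ but $p_I(x) \notin \partial p_I(B)$. A point $x \in B$ is a special corner of $B$ with respect to the basis if $p_i(x) \in \partial p_i(B)$ for all $i = 1, \dots, n+1$. *)

theory Defs
  imports "HOL-Analysis.Analysis"
begin

definition strictly_convex :: "'a::euclidean_space set \<Rightarrow> bool" where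
  "strictly_convex B \<longleftrightarrow> (\<forall>x\<in>B. \<forall>y\<in>B. open_segment x y \<subseteq> interior B)"

text \<open>An ordered orthonormal basis of the ambient space; only the values
  \<open>v 1, \<dots>, v N\<close> matter.\<close>

definition orthonormal_basis :: "nat \<Rightarrow> (nat \<Rightarrow> 'a::euclidean_space) \<Rightarrow> bool" where
  "orthonormal_basis N v \<longleftrightarrow>
     (\<forall>i\<in>{1..N}. \<forall>j\<in>{1..N}. v i \<bullet> v j = (if i = j then 1 else 0)) \<and>
     span (v ` {1..N}) = UNIV"

text \<open>The projection \<open>p\<^sub>I\<close>, for orthonormal \<open>v i\<close> with \<open>i \<in> I\<close>; the projection \<open>p\<^sub>i\<close> onto
  the hyperplane orthogonal to \<open>v i\<close> is \<open>proj v {i}\<close>. The lemmas below confirm that \<open>proj v I\<close>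
  is the composition of the \<open>p\<^sub>i\<close> and the orthogonal projection onto \<open>(v ` I)\<^sup>\<bottom>\<close>.\<close>

definition proj :: "(nat \<Rightarrow> 'a::euclidean_space) \<Rightarrow> nat set \<Rightarrow> 'a \<Rightarrow> 'a" where
  "proj v I x = x - (\<Sum>i\<in>I. (x \<bullet> v i) *\<^sub>R v i)"

lemma proj_singleton: "proj v {i} x = x - (x \<bullet> v i) *\<^sub>R v i"
  by (simp add: proj_def)

lemma proj_insert:
  assumes "orthonormal_basis N v" "insert i I \<subseteq> {1..N}" "i \<notin> I"
  shows "proj v (insert i I) = proj v {i} \<circ> proj v I"
proof
  fix x
  have fin: "finite I" using assms(2) by (auto intro: finite_subset)
  have "(\<Sum>j\<in>I. (x \<bullet> v j) * (v j \<bullet> v i)) = 0"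
    using assms by (intro sum.neutral) (auto simp: orthonormal_basis_def subset_eq)
  then show "proj v (insert i I) x = (proj v {i} \<circ> proj v I) x"
    using fin assms(3) by (simp add: proj_def inner_diff_left inner_sum_left)
qed

lemma proj_in_comp:
  assumes "orthonormal_basis N v" "I \<subseteq> {1..N}"
  shows "proj v I x \<in> (v ` I)\<^sup>\<bottom>"
proof -
  have fin: "finite I" using assms(2) by (auto intro: finite_subset)
  have "proj v I x \<bullet> v i = 0" if "i \<in> I" for i
  proof -
    have "(\<Sum>j\<in>I. (x \<bullet> v j) * (v j \<bullet> v i)) = (\<Sum>j\<in>I. if j = i then x \<bullet> v j else 0)"
      using assms that by (intro sum.cong) (auto simp: orthonormal_basis_def subset_eq)
    then show ?thesis using fin that
      by (simp add: proj_def inner_diff_left inner_sum_left)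
  qed
  then show ?thesis
    by (auto simp: orthogonal_comp_def orthogonal_def inner_commute)
qed

lemma proj_residual_orthogonal:
  assumes "y \<in> (v ` I)\<^sup>\<bottom>"
  shows "orthogonal (x - proj v I x) y"
  using assms by (auto simp: proj_def orthogonal_comp_def orthogonal_def inner_sum_left)

text \<open>Boundary and interior of \<open>p\<^sub>I(B)\<close> relative to the subspace \<open>(v ` I)\<^sup>\<bottom>\<close>.\<close>

definition proj_frontier :: "(nat \<Rightarrow> 'a::euclidean_space) \<Rightarrow> nat set \<Rightarrow> 'a set \<Rightarrow> 'a set" where
  "proj_frontier v I B = top_of_set ((v ` I)\<^sup>\<bottom>) frontier_of (proj v I ` B)"

definition proj_interior :: "(nat \<Rightarrow> 'a::euclidean_space) \<Rightarrow> nat set \<Rightarrow> 'a set \<Rightarrow> 'a set" where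
  "proj_interior v I B = top_of_set ((v ` I)\<^sup>\<bottom>) interior_of (proj v I ` B)"

definition D_zero :: "(nat \<Rightarrow> 'a::euclidean_space) \<Rightarrow> 'a set \<Rightarrow> nat \<Rightarrow> 'a set" where
  "D_zero v B i = {x \<in> B. proj v {i} x \<in> proj_frontier v {i} B}"

text \<open>The points \<open>x\<^sup>+\<close> and \<open>x\<^sup>-\<close>, meaningful only for \<open>x \<in> proj_interior v {i} B\<close>, where
  exactly two points of \<open>frontier B\<close> project to \<open>x\<close>.\<close>

definition upper_point :: "(nat \<Rightarrow> 'a::euclidean_space) \<Rightarrow> 'a set \<Rightarrow> nat \<Rightarrow> 'a \<Rightarrow> 'a" where
  "upper_point v B i x = (ARG_MAX (\<lambda>u. u \<bullet> v i) u. u \<in> frontier B \<and> proj v {i} u = x)"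

definition lower_point :: "(nat \<Rightarrow> 'a::euclidean_space) \<Rightarrow> 'a set \<Rightarrow> nat \<Rightarrow> 'a \<Rightarrow> 'a" where
  "lower_point v B i x = (ARG_MIN (\<lambda>u. u \<bullet> v i) u. u \<in> frontier B \<and> proj v {i} u = x)"

definition U_plus :: "(nat \<Rightarrow> 'a::euclidean_space) \<Rightarrow> 'a set \<Rightarrow> nat \<Rightarrow> 'a set" where
  "U_plus v B i = upper_point v B i ` proj_interior v {i} B"

definition U_minus :: "(nat \<Rightarrow> 'a::euclidean_space) \<Rightarrow> 'a set \<Rightarrow> nat \<Rightarrow> 'a set" where
  "U_minus v B i = lower_point v B i ` proj_interior v {i} B"

definition D_plus :: "(nat \<Rightarrow> 'a::euclidean_space) \<Rightarrow> 'a set \<Rightarrow> nat \<Rightarrow> 'a set" where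
  "D_plus v B i = D_zero v B i \<union> U_plus v B i"

definition D_minus :: "(nat \<Rightarrow> 'a::euclidean_space) \<Rightarrow> 'a set \<Rightarrow> nat \<Rightarrow> 'a set" where
  "D_minus v B i = D_zero v B i \<union> U_minus v B i"

text \<open>Below, the ambient dimension is \<open>n + 1\<close>.\<close>

definition regular_wrt :: "nat \<Rightarrow> (nat \<Rightarrow> 'a::euclidean_space) \<Rightarrow> 'a set \<Rightarrow> bool" where
  "regular_wrt n v B \<longleftrightarrow>
     \<not> (\<exists>I x. I \<noteq> {} \<and> I \<subseteq> {1..n+1} \<and> card I \<le> n \<and> x \<in> B \<and>
          (\<forall>i\<in>I. proj v {i} x \<in> proj_frontier v {i} B) \<and>
          proj v I x \<notin> proj_frontier v I B)"

definition special_corner :: "nat \<Rightarrow> (nat \<Rightarrow> 'a::euclidean_space) \<Rightarrow> 'a set \<Rightarrow> 'a \<Rightarrow> bool" where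
  "special_corner n v B x \<longleftrightarrow>
     x \<in> B \<and> (\<forall>i\<in>{1..n+1}. proj v {i} x \<in> proj_frontier v {i} B)"

text \<open>By the next lemma, intersecting with \<open>frontier B\<close> changes an intersection of sets \<open>D_zero v B i\<close> only
  when the index set is empty.\<close>

lemma D_zero_subset_frontier:
  fixes v :: "nat \<Rightarrow> 'a::euclidean_space"
  assumes "norm (v i) = 1"
  shows "D_zero v B i \<subseteq> frontier B"
proof
  fix x assume x: "x \<in> D_zero v B i"
  have vv: "v i \<bullet> v i = 1" using assms by (simp add: norm_eq_1)
  have "x \<notin> interior B"
  proof
    assume int: "x \<in> interior B"
    let ?g = "\<lambda>y. y + (x \<bullet> v i) *\<^sub>R v i"
    let ?T = "(v ` {i})\<^sup>\<bottom> \<inter> ?g -` interior B"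
    have "openin (top_of_set ((v ` {i})\<^sup>\<bottom>)) ?T"
      by (intro continuous_openin_preimage_gen continuous_intros) auto
    moreover have "proj v {i} x \<in> ?T"
      using int vv
      by (auto simp: proj_def orthogonal_comp_def orthogonal_def inner_diff_right inner_commute)
    moreover have "?T \<subseteq> proj v {i} ` B"
    proof
      fix y assume y: "y \<in> ?T"
      then have "y \<bullet> v i = 0"
        by (auto simp: orthogonal_comp_def orthogonal_def inner_commute)
      then have "proj v {i} (?g y) = y" using vv by (simp add: proj_def inner_add_left)
      moreover have "?g y \<in> B" using y interior_subset by auto
      ultimately show "y \<in> proj v {i} ` B" by (metis imageI)
    qed
    ultimately have "proj v {i} x \<in> top_of_set ((v ` {i})\<^sup>\<bottom>) interior_of (proj v {i} ` B)"
      unfolding interior_of_def by blast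
    then show False using x by (simp add: D_zero_def proj_frontier_def frontier_of_def)
  qed
  then show "x \<in> frontier B"
    using x closure_subset by (auto simp: D_zero_def frontier_def)
qed

end

theory Submission
  imports Defs
begin

text \<open>
  Everything rests on one description of the shadow boundary: since \<open>p\<^sub>I\<close> is linear and \<open>B\<close> is
  convex with interior points, the relative interior of \<open>p\<^sub>I(B)\<close> is the image \<open>p\<^sub>I(int B)\<close>
  (\<open>proj_interior_eq\<close>). A point \<open>x\<close> of \<open>B\<close> is therefore projected into \<open>\<partial>p\<^sub>I(B)\<close> exactly when the fibre of
  \<open>p\<^sub>I\<close> through \<open>x\<close> misses the interior of \<open>B\<close>. The set of these \<open>x\<close> is called \<open>shadow\<close> below.

  Fibres grow with \<open>I\<close>, so the shadow of \<open>p\<^sub>I\<close> lies in every \<open>D\<^sub>i\<^sup>0\<close> with \<open>i \<in> I\<close>; regularity is the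
  converse, and hence \<open>\<Inter>\<^sub>i\<^sub>\<in>\<^sub>I D\<^sub>i\<^sup>0\<close> is the shadow of \<open>p\<^sub>I\<close> (\<open>Inter_D_zero_eq_shadow\<close>). With
  \<open>I = {}\<close> the shadow is \<open>\<partial>B\<close> itself, so this case needs no separate treatment.

  Strict convexity makes \<open>p\<^sub>I\<close> injective on the shadow: the midpoint of two points in one fibre would
  be an interior point of \<open>B\<close> in that fibre. Being a continuous bijection from a compact set onto
  \<open>\<partial>p\<^sub>I(B)\<close>, \<open>p\<^sub>I\<close> is a homeomorphism. Finally \<open>p\<^sub>I(B)\<close> is a convex body in a space of dimension
  \<open>n + 1 - k > 0\<close>, so its boundary is a sphere of dimension \<open>n - k\<close>.

  For the second claim, \<open>p\<^sub>I\<close> with \<open>I\<close> the complement of \<open>j\<close> records only the \<open>v\<^sub>j\<close>-coordinate, and the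
  shadow consists of the two points where this coordinate is extremal on \<open>B\<close>
  (\<open>extremal_pair\<close>). The third claim says that there are no special corners.
\<close>

section \<open>Coordinates for the projections\<close>

lemma linear_proj: "linear (proj v I)"
  by (rule linearI)
    (simp_all add: proj_def inner_add_left scaleR_left_distrib sum.distrib
      scaleR_right_diff_distrib scaleR_sum_right)

lemma orthonormal_basis_expansion:
  assumes "orthonormal_basis N v"
  shows "x = (\<Sum>i\<in>{1..N}. (x \<bullet> v i) *\<^sub>R v i)"
proof -
  let ?d = "proj v {1..N} x"
  have "orthogonal ?d y" if "y \<in> v ` {1..N}" for y
    using proj_in_comp[OF assms order_refl, of x] that
    by (auto simp: orthogonal_comp_def orthogonal_commute)
  then have "orthogonal ?d y" if "y \<in> span (v ` {1..N})" for y
    using that orthogonal_to_span by blast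
  then have "orthogonal ?d ?d"
    using assms by (simp add: orthonormal_basis_def)
  then have "?d = 0" by (simp add: orthogonal_self)
  then show ?thesis by (simp add: proj_def)
qed

lemma orthonormal_basis_eqI:
  assumes "orthonormal_basis N v" "\<And>i. i \<in> {1..N} \<Longrightarrow> x \<bullet> v i = y \<bullet> v i"
  shows "x = y"
  using orthonormal_basis_expansion[OF assms(1), of x] orthonormal_basis_expansion[OF assms(1), of y]
    assms(2) by simp

lemma mem_orthogonal_comp_image: "x \<in> (v ` I)\<^sup>\<bottom> \<longleftrightarrow> (\<forall>i\<in>I. x \<bullet> v i = 0)"
  by (auto simp: orthogonal_comp_def orthogonal_def inner_commute)

lemma inner_proj:
  assumes "orthonormal_basis N v" "I \<subseteq> {1..N}" "j \<in> {1..N}"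
  shows "proj v I x \<bullet> v j = (if j \<in> I then 0 else x \<bullet> v j)"
proof -
  have "finite I" using assms(2) finite_subset by blast
  have "(\<Sum>i\<in>I. (x \<bullet> v i) * (v i \<bullet> v j)) = (\<Sum>i\<in>I. if i = j then x \<bullet> v j else 0)"
    using assms by (intro sum.cong) (auto simp: orthonormal_basis_def subset_eq)
  then show ?thesis
    using \<open>finite I\<close> by (simp add: proj_def inner_diff_left inner_sum_left)
qed

lemma proj_eq_iff:
  assumes "orthonormal_basis N v" "I \<subseteq> {1..N}"
  shows "proj v I x = proj v I y \<longleftrightarrow> (\<forall>j\<in>{1..N} - I. x \<bullet> v j = y \<bullet> v j)"
proof
  assume "proj v I x = proj v I y"
  then show "\<forall>j\<in>{1..N} - I. x \<bullet> v j = y \<bullet> v j"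
    by (metis DiffD1 DiffD2 inner_proj[OF assms])
next
  assume "\<forall>j\<in>{1..N} - I. x \<bullet> v j = y \<bullet> v j"
  then show "proj v I x = proj v I y"
    by (intro orthonormal_basis_eqI[OF assms(1)]) (simp add: inner_proj[OF assms])
qed

lemma range_proj:
  assumes "orthonormal_basis N v" "I \<subseteq> {1..N}"
  shows "range (proj v I) = (v ` I)\<^sup>\<bottom>"
proof
  show "range (proj v I) \<subseteq> (v ` I)\<^sup>\<bottom>"
    using proj_in_comp[OF assms] by auto
  show "(v ` I)\<^sup>\<bottom> \<subseteq> range (proj v I)"
  proof
    fix x assume "x \<in> (v ` I)\<^sup>\<bottom>"
    then have "proj v I x = x"
      by (simp add: proj_def mem_orthogonal_comp_image)
    then show "x \<in> range (proj v I)" by (metis rangeI)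
  qed
qed

section \<open>Projections of convex bodies and their shadows\<close>

lemma strictly_convex_imp_convex:
  assumes "strictly_convex B"
  shows "convex B"
  unfolding convex_contains_segment closed_segment_eq_open
  using assms interior_subset[of B] by (fastforce simp: strictly_convex_def)

lemma affine_hull_proj:
  assumes "orthonormal_basis N v" "I \<subseteq> {1..N}" "interior B \<noteq> {}"
  shows "affine hull (proj v I ` B) = (v ` I)\<^sup>\<bottom>"
  using affine_hull_linear_image[of "proj v I" B] affine_hull_nonempty_interior[OF assms(3)]
    range_proj[OF assms(1,2)] linear_proj[of v I] by (simp add: linear_conv_bounded_linear)

text \<open>The projected body spans \<open>(v ` I)\<^sup>\<bottom>\<close>, so its interior there is its relative interior, and relative
  interiors of convex sets commute with linear maps.\<close>

lemma proj_interior_eq: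
  assumes "orthonormal_basis N v" "I \<subseteq> {1..N}" "convex B" "interior B \<noteq> {}"
  shows "proj_interior v I B = proj v I ` interior B"
    and "proj_interior v I B = rel_interior (proj v I ` B)"
proof -
  show *: "proj_interior v I B = rel_interior (proj v I ` B)"
    by (simp add: proj_interior_def interior_of_def rel_interior_def affine_hull_proj[OF assms(1,2,4)])
  show "proj_interior v I B = proj v I ` interior B"
    using rel_interior_convex_linear_image[OF linear_proj assms(3), of v I]
      rel_interior_nonempty_interior[OF assms(4)] * by simp
qed

lemma proj_frontier_eq:
  assumes "orthonormal_basis N v" "I \<subseteq> {1..N}" "convex B" "interior B \<noteq> {}" "compact B"
  shows "proj_frontier v I B = proj v I ` B - proj v I ` interior B"
    and "proj_frontier v I B = rel_frontier (proj v I ` B)"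
proof -
  have "compact (proj v I ` B)"
    using assms(5) linear_proj by (intro compact_continuous_image linear_continuous_on)
      (auto simp: linear_conv_bounded_linear)
  then have cl: "closed (proj v I ` B)"
    by (rule compact_imp_closed)
  moreover have "proj v I ` B \<subseteq> (v ` I)\<^sup>\<bottom>"
    using proj_in_comp[OF assms(1,2)] by auto
  ultimately have "closedin (top_of_set ((v ` I)\<^sup>\<bottom>)) (proj v I ` B)"
    by (simp add: closed_subset)
  then have *: "proj_frontier v I B = proj v I ` B - proj_interior v I B"
    by (simp add: proj_frontier_def proj_interior_def frontier_of_def closure_of_closedin)
  show "proj_frontier v I B = proj v I ` B - proj v I ` interior B"
    using * proj_interior_eq(1)[OF assms(1-4)] by simp
  show "proj_frontier v I B = rel_frontier (proj v I ` B)"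
    using * proj_interior_eq(2)[OF assms(1-4)] cl by (simp add: rel_frontier_def)
qed

text \<open>The points of \<open>B\<close> at which the fibre of \<open>f\<close> only touches \<open>B\<close>. For \<open>f = p\<^sub>I\<close> and a convex body \<open>B\<close>
  these are the points projected into \<open>\<partial>p\<^sub>I(B)\<close>; this form depends only on the fibres of \<open>f\<close>, which
  makes shadows of different projections comparable.\<close>

definition shadow :: "('a::euclidean_space \<Rightarrow> 'b) \<Rightarrow> 'a set \<Rightarrow> 'a set" where
  "shadow f B = {x \<in> B. f x \<notin> f ` interior B}"

lemma proj_in_proj_frontier_iff:
  assumes "orthonormal_basis N v" "I \<subseteq> {1..N}" "convex B" "interior B \<noteq> {}" "compact B" "x \<in> B"
  shows "proj v I x \<in> proj_frontier v I B \<longleftrightarrow> x \<in> shadow (proj v I) B"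
  using proj_frontier_eq(1)[OF assms(1-5)] assms(6) by (auto simp: shadow_def)

lemma D_zero_eq_shadow:
  assumes "orthonormal_basis N v" "i \<in> {1..N}" "convex B" "interior B \<noteq> {}" "compact B"
  shows "D_zero v B i = shadow (proj v {i}) B"
  using proj_in_proj_frontier_iff[OF assms(1) _ assms(3-5), of "{i}"] assms(2)
  by (auto simp: D_zero_def shadow_def)

lemma shadow_subset_frontier: "shadow f B \<subseteq> frontier B"
  using closure_subset[of B] by (auto simp: shadow_def frontier_def)

lemma shadow_proj_antimono:
  assumes "orthonormal_basis N v" "J \<subseteq> I" "I \<subseteq> {1..N}"
  shows "shadow (proj v I) B \<subseteq> shadow (proj v J) B"
proof -
  have "J \<subseteq> {1..N}" using assms(2,3) by blast
  have "proj v I x = proj v I y" if "proj v J x = proj v J y" for x y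
    using that assms(2) unfolding proj_eq_iff[OF assms(1) \<open>J \<subseteq> {1..N}\<close>] proj_eq_iff[OF assms(1,3)]
    by blast
  then show ?thesis unfolding shadow_def by blast
qed

lemma Inter_D_zero_eq_shadow:
  assumes "orthonormal_basis (n + 1) v" "convex B" "interior B \<noteq> {}" "compact B"
    and "regular_wrt n v B" "I \<subseteq> {1..n+1}" "card I \<le> n"
  shows "frontier B \<inter> (\<Inter>i\<in>I. D_zero v B i) = shadow (proj v I) B"
proof (cases "I = {}")
  case True
  then have "shadow (proj v I) B = B - interior B"
    by (auto simp: shadow_def proj_def)
  with True show ?thesis
    using compact_imp_closed[OF assms(4)] by (simp add: frontier_def)
next
  case False
  show ?thesis
  proof
    show "frontier B \<inter> (\<Inter>i\<in>I. D_zero v B i) \<subseteq> shadow (proj v I) B"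
    proof
      fix x assume x: "x \<in> frontier B \<inter> (\<Inter>i\<in>I. D_zero v B i)"
      then have "x \<in> B" "\<forall>i\<in>I. proj v {i} x \<in> proj_frontier v {i} B"
        using False by (auto simp: D_zero_def)
      then have "proj v I x \<in> proj_frontier v I B"
        using assms(5,6,7) False unfolding regular_wrt_def by blast
      then show "x \<in> shadow (proj v I) B"
        using proj_in_proj_frontier_iff[OF assms(1,6,2,3,4) \<open>x \<in> B\<close>] by blast
    qed
    have "shadow (proj v I) B \<subseteq> D_zero v B i" if "i \<in> I" for i
    proof -
      have "i \<in> {1..n+1}" using that assms(6) by blast
      then show ?thesis
        using that assms(6) shadow_proj_antimono[OF assms(1), of "{i}" I B]
          D_zero_eq_shadow[OF assms(1) _ assms(2-4), of i] by simp
    qed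
    then show "shadow (proj v I) B \<subseteq> frontier B \<inter> (\<Inter>i\<in>I. D_zero v B i)"
      using shadow_subset_frontier by blast
  qed
qed

text \<open>Two points of the shadow in one fibre would have an interior point of \<open>B\<close> between them, and by
  linearity the fibre contains it.\<close>

lemma inj_on_shadow:
  assumes "strictly_convex B" "linear f"
  shows "inj_on f (shadow f B)"
proof (rule inj_onI, rule ccontr)
  fix x y assume xy: "x \<in> shadow f B" "y \<in> shadow f B" "f x = f y" "x \<noteq> y"
  let ?m = "midpoint x y"
  have "?m \<in> open_segment x y" using xy(4) by simp
  then have "?m \<in> interior B"
    using assms(1) xy(1,2) unfolding strictly_convex_def shadow_def by blast
  moreover have "f ?m = f x"
    using xy(3) by (simp add: midpoint_def linear_cmul[OF assms(2)] linear_add[OF assms(2)]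
        flip: scaleR_2)
  ultimately show False
    using xy(1) unfolding shadow_def by (metis (no_types, lifting) CollectD imageI)
qed

lemma shadow_homeomorphic_proj_frontier:
  assumes "orthonormal_basis N v" "I \<subseteq> {1..N}" "strictly_convex B" "interior B \<noteq> {}" "compact B"
  shows "shadow (proj v I) B homeomorphic rel_frontier (proj v I ` B)"
proof (rule homeomorphic_compact)
  have conv: "convex B" by (rule strictly_convex_imp_convex[OF assms(3)])
  have cont: "continuous_on S (proj v I)" for S
    using linear_proj by (intro linear_continuous_on) (auto simp: linear_conv_bounded_linear)
  then show "continuous_on (shadow (proj v I) B) (proj v I)" .
  note fr = proj_frontier_eq[OF assms(1,2) conv assms(4,5)]
  show image: "proj v I ` shadow (proj v I) B = rel_frontier (proj v I ` B)"
    using fr by (auto simp: shadow_def)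
  show "inj_on (proj v I) (shadow (proj v I) B)"
    by (rule inj_on_shadow[OF assms(3) linear_proj])
  have "compact (rel_frontier (proj v I ` B))"
    using compact_continuous_image[OF cont assms(5)] compact_rel_frontier_bounded
      compact_imp_bounded by blast
  then have "closed (B \<inter> proj v I -` rel_frontier (proj v I ` B))"
    using assms(5) cont by (intro continuous_closed_preimage) (auto intro: compact_imp_closed)
  moreover have "shadow (proj v I) B = B \<inter> proj v I -` rel_frontier (proj v I ` B)"
    using fr by (auto simp: shadow_def)
  ultimately show "compact (shadow (proj v I) B)"
    using assms(5) by (metis Int_lower1 bounded_subset compact_eq_bounded_closed)
qed

section \<open>The boundary of a projected convex body is a standard sphere\<close>

text \<open>Both sides bound convex bodies spanning the same subspace.\<close>

lemma rel_frontier_homeomorphic_subspace_sphere: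
  fixes K :: "'a::euclidean_space set"
  assumes "convex K" "bounded K" "subspace W" "affine hull K = W"
  shows "rel_frontier K homeomorphic sphere 0 1 \<inter> W"
proof -
  have 0: "0 \<in> interior (cball 0 1) \<inter> W"
    using subspace_0[OF assms(3)] by simp
  have conv: "convex W" by (rule subspace_imp_convex[OF assms(3)])
  have "aff_dim (W \<inter> cball 0 1) = aff_dim W"
    by (rule aff_dim_convex_Int_nonempty_interior[OF conv]) (use 0 in blast)
  also have "\<dots> = aff_dim K"
    using assms(4) aff_dim_affine_hull[of K] by simp
  finally have "aff_dim K = aff_dim (cball 0 1 \<inter> W)"
    by (simp add: Int_commute)
  then have "rel_frontier K homeomorphic rel_frontier (cball 0 1 \<inter> W)"
    by (intro homeomorphic_rel_frontiers_convex_bounded_sets assms(1,2) convex_Int convex_cball conv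
        bounded_Int disjI1 bounded_cball)
  also have "rel_frontier (cball 0 1 \<inter> W) = frontier (cball 0 1) \<inter> W"
    by (rule convex_affine_rel_frontier_Int[OF convex_cball subspace_imp_affine[OF assms(3)]])
      (use 0 in blast)
  also have "\<dots> = sphere 0 1 \<inter> W" by simp
  finally show ?thesis .
qed

lemma homeomorphic_imp_homeomorphic_space:
  "S homeomorphic T \<Longrightarrow> top_of_set S homeomorphic_space top_of_set T"
  unfolding homeomorphic_def homeomorphism_def homeomorphic_space_def homeomorphic_maps_def
  by (fastforce simp: continuous_map_in_subtopology)

lemma nsphere_eq_top_of_set:
  "nsphere m = top_of_set {x. (\<Sum>k\<le>m. (x k)\<^sup>2) = 1 \<and> (\<forall>k>m. x k = 0)}"
  by (simp add: nsphere euclidean_product_topology)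

text \<open>The homeomorphism lists the coordinates with respect to the basis vectors not indexed by \<open>I\<close>
  and pads them with zeros.\<close>

lemma subspace_sphere_homeomorphic_nsphere:
  fixes v :: "nat \<Rightarrow> 'a::euclidean_space"
  assumes "orthonormal_basis N v" "I \<subseteq> {1..N}" "card ({1..N} - I) = Suc m"
  shows "top_of_set (sphere 0 1 \<inter> (v ` I)\<^sup>\<bottom>) homeomorphic_space nsphere m"
proof -
  let ?J = "{1..N} - I" and ?W = "(v ` I)\<^sup>\<bottom>"
  obtain e where e: "bij_betw e {..m} ?J"
    using assms(3) by (metis card_atMost finite_Diff finite_atLeastAtMost finite_atMost
        finite_same_card_bij)
  define f where "f x = (\<lambda>k. if k \<le> m then x \<bullet> v (e k) else 0)" for x :: 'a
  define T where "T = {y :: nat \<Rightarrow> real. (\<Sum>k\<le>m. (y k)\<^sup>2) = 1 \<and> (\<forall>k>m. y k = 0)}"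
  have norm: "(\<Sum>k\<le>m. (f x k)\<^sup>2) = (norm x)\<^sup>2" if "x \<in> ?W" for x
  proof -
    have "(norm x)\<^sup>2 = x \<bullet> (\<Sum>i\<in>{1..N}. (x \<bullet> v i) *\<^sub>R v i)"
      using orthonormal_basis_expansion[OF assms(1), of x] by (simp add: power2_norm_eq_inner)
    also have "\<dots> = (\<Sum>i\<in>{1..N}. (x \<bullet> v i)\<^sup>2)"
      by (simp add: inner_sum_right power2_eq_square)
    also have "\<dots> = (\<Sum>i\<in>?J. (x \<bullet> v i)\<^sup>2)"
      using that by (intro sum.mono_neutral_right) (auto simp: mem_orthogonal_comp_image)
    also have "\<dots> = (\<Sum>k\<le>m. (x \<bullet> v (e k))\<^sup>2)"
      using sum.reindex_bij_betw[OF e, of "\<lambda>i. (x \<bullet> v i)\<^sup>2"] by simp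
    finally show ?thesis by (simp add: f_def)
  qed
  have "sphere 0 1 \<inter> ?W homeomorphic T"
  proof (rule homeomorphic_compact[where f = f])
    show "compact (sphere 0 1 \<inter> ?W)"
      by (intro compact_Int_closed compact_sphere closed_subspace subspace_orthogonal_comp)
    show "continuous_on (sphere 0 1 \<inter> ?W) f"
    proof (rule continuous_on_coordinatewise_then_product)
      show "continuous_on (sphere 0 1 \<inter> ?W) (\<lambda>x. f x k)" for k
        by (cases "k \<le> m") (auto simp: f_def intro!: continuous_intros)
    qed
    show "inj_on f (sphere 0 1 \<inter> ?W)"
    proof (rule inj_onI)
      fix x y assume x: "x \<in> sphere 0 1 \<inter> ?W" and y: "y \<in> sphere 0 1 \<inter> ?W" and eq: "f x = f y"
      have "x \<bullet> v (e k) = y \<bullet> v (e k)" if "k \<le> m" for k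
        using fun_cong[OF eq, of k] that by (simp add: f_def)
      then have "x \<bullet> v i = y \<bullet> v i" if "i \<in> ?J" for i
        using that e by (metis atMost_iff bij_betw_imp_surj_on imageE)
      then show "x = y"
        using x y by (intro orthonormal_basis_eqI[OF assms(1)])
          (metis DiffI IntD2 mem_orthogonal_comp_image)
    qed
    show "f ` (sphere 0 1 \<inter> ?W) = T"
    proof
      show "f ` (sphere 0 1 \<inter> ?W) \<subseteq> T"
        using norm by (auto simp: T_def f_def)
      show "T \<subseteq> f ` (sphere 0 1 \<inter> ?W)"
      proof
        fix y assume y: "y \<in> T"
        define x where "x = (\<Sum>k\<le>m. y k *\<^sub>R v (e k))"
        have eJ: "e k \<in> ?J" if "k \<le> m" for k
          using e that by (auto simp: bij_betw_def)
        have inj: "e k = e l \<longleftrightarrow> k = l" if "k \<le> m" "l \<le> m" for k l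
          using e that by (auto simp: bij_betw_def inj_on_def)
        have W: "x \<in> ?W"
          unfolding mem_orthogonal_comp_image x_def inner_sum_left
        proof (intro ballI sum.neutral)
          fix i k assume "i \<in> I" "k \<in> {..m}"
          then have "i \<in> {1..N}" "e k \<in> {1..N}" "e k \<noteq> i"
            using assms(2) eJ[of k] by auto
          then show "(y k *\<^sub>R v (e k)) \<bullet> v i = 0"
            using assms(1) unfolding orthonormal_basis_def by simp
        qed
        have "x \<bullet> v (e l) = y l" if "l \<le> m" for l
        proof -
          have "x \<bullet> v (e l) = (\<Sum>k\<le>m. if k = l then y l else 0)"
            unfolding x_def inner_sum_left
            using assms(1) eJ inj that
            by (intro sum.cong) (auto simp: orthonormal_basis_def simp del: atLeastAtMost_iff)
          then show ?thesis using that by simp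
        qed
        then have fx: "f x = y"
          using y by (auto simp: f_def T_def)
        then have "norm x = 1"
          using norm[OF W] y by (simp add: T_def power2_eq_1_iff)
             (smt (verit) norm_ge_zero)
        then show "y \<in> f ` (sphere 0 1 \<inter> ?W)"
          using fx W by (intro image_eqI[where x = x]) auto
      qed
    qed
  qed
  then show ?thesis
    unfolding nsphere_eq_top_of_set T_def[symmetric] by (rule homeomorphic_imp_homeomorphic_space)
qed

lemma shadow_homeomorphic_nsphere:
  fixes v :: "nat \<Rightarrow> 'a::euclidean_space"
  assumes "orthonormal_basis N v" "I \<subseteq> {1..N}" "card ({1..N} - I) = Suc m"
    and "strictly_convex B" "interior B \<noteq> {}" "compact B"
  shows "top_of_set (shadow (proj v I) B) homeomorphic_space nsphere m"
proof -
  have "bounded (proj v I ` B)"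
    using assms(6) linear_proj[of v I]
    by (simp add: bounded_linear_image compact_imp_bounded linear_conv_bounded_linear)
  moreover have "convex (proj v I ` B)"
    using strictly_convex_imp_convex[OF assms(4)] linear_proj convex_linear_image by blast
  ultimately have "rel_frontier (proj v I ` B) homeomorphic sphere 0 1 \<inter> (v ` I)\<^sup>\<bottom>"
    by (intro rel_frontier_homeomorphic_subspace_sphere subspace_orthogonal_comp
        affine_hull_proj[OF assms(1,2,5)])
  with shadow_homeomorphic_proj_frontier[OF assms(1,2,4-6)]
  have "shadow (proj v I) B homeomorphic sphere 0 1 \<inter> (v ` I)\<^sup>\<bottom>"
    by (rule homeomorphic_trans)
  then show ?thesis
    using homeomorphic_imp_homeomorphic_space subspace_sphere_homeomorphic_nsphere[OF assms(1-3)]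
      homeomorphic_space_trans by blast
qed

section \<open>Extremal points in a basis direction\<close>

text \<open>An interior point can be moved in both directions along \<open>w\<close>, so extremal points have the value
  of no interior point. Conversely a value strictly between the extremal ones is taken on the open
  segment joining the extremal points, which is interior by strict convexity.\<close>

lemma extremal_pair:
  fixes B :: "'a::euclidean_space set"
  assumes "compact B" "strictly_convex B" "interior B \<noteq> {}" "w \<noteq> 0"
  obtains xp xm where "xp \<noteq> xm" "shadow (\<lambda>x. x \<bullet> w) B = {xp, xm}"
    "\<forall>y\<in>B. y \<bullet> w \<le> xp \<bullet> w" "\<forall>y\<in>B. xm \<bullet> w \<le> y \<bullet> w"
proof -
  let ?h = "\<lambda>x. x \<bullet> w"
  have ne: "B \<noteq> {}" using assms(3) interior_subset by blast
  have cont: "continuous_on B ?h" by (intro continuous_intros)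
  obtain xp where xp: "xp \<in> B" "\<forall>y\<in>B. ?h y \<le> ?h xp"
    using continuous_attains_sup[OF assms(1) ne cont] by blast
  obtain xm where xm: "xm \<in> B" "\<forall>y\<in>B. ?h xm \<le> ?h y"
    using continuous_attains_inf[OF assms(1) ne cont] by blast
  have lt: "?h xm < ?h y \<and> ?h y < ?h xp" if "y \<in> interior B" for y
  proof -
    obtain r where r: "r > 0" "cball y r \<subseteq> B"
      using \<open>y \<in> interior B\<close> mem_interior_cball by blast
    let ?d = "(r / norm w) *\<^sub>R w"
    have "y + ?d \<in> B" "y - ?d \<in> B"
      using r assms(4) by (auto simp: subset_eq dist_norm)
    moreover have "?d \<bullet> w > 0"
      using r(1) assms(4) by simp
    ultimately show ?thesis
      using xp(2) xm(2) by (fastforce simp: inner_add_left inner_diff_left)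
  qed
  then have xp': "xp \<in> shadow ?h B" and xm': "xm \<in> shadow ?h B"
    using xp(1) xm(1) by (force simp: shadow_def)+
  have "?h xm < ?h xp" using assms(3) lt by fastforce
  then have neq: "xp \<noteq> xm" by auto
  have inj: "inj_on ?h (shadow ?h B)"
    using assms(2) bounded_linear_inner_left
    by (intro inj_on_shadow) (auto simp: linear_conv_bounded_linear)
  have "x \<in> {xp, xm}" if x: "x \<in> shadow ?h B" for x
  proof (rule ccontr)
    assume "x \<notin> {xp, xm}"
    then have "?h x \<noteq> ?h xp" "?h x \<noteq> ?h xm"
      using inj x xp' xm' by (auto dest: inj_onD)
    moreover have "?h xm \<le> ?h x" "?h x \<le> ?h xp"
      using x xp(2) xm(2) by (auto simp: shadow_def)
    ultimately have strict: "?h xm < ?h x" "?h x < ?h xp" by auto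
    define u where "u = (?h x - ?h xm) / (?h xp - ?h xm)"
    have u: "0 < u" "u < 1" using strict by (auto simp: u_def)
    let ?z = "(1 - u) *\<^sub>R xm + u *\<^sub>R xp"
    have "?z \<in> open_segment xm xp"
      using neq u by (auto simp: in_segment)
    then have "?z \<in> interior B"
      using assms(2) xp(1) xm(1) by (auto simp: strictly_convex_def)
    moreover have "?h ?z = ?h xm + u * (?h xp - ?h xm)"
      by (simp add: inner_add_left algebra_simps)
    then have "?h ?z = ?h x"
      using strict by (simp add: u_def)
    ultimately show False
      using x unfolding shadow_def by (metis (no_types, lifting) CollectD imageI)
  qed
  then have "shadow ?h B = {xp, xm}" using xp' xm' by auto
  then show thesis using that neq xp(2) xm(2) by blast
qed

lemma shadow_proj_complement:
  assumes "orthonormal_basis N v" "j \<in> {1..N}"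
  shows "shadow (proj v ({1..N} - {j})) B = shadow (\<lambda>x. x \<bullet> v j) B"
proof -
  have "proj v ({1..N} - {j}) x = proj v ({1..N} - {j}) y \<longleftrightarrow> x \<bullet> v j = y \<bullet> v j" for x y
    using proj_eq_iff[OF assms(1), of "{1..N} - {j}"] assms(2) by auto
  then show ?thesis by (auto simp: shadow_def image_iff)
qed

lemma proj_singleton_eq_imp_eq:
  assumes "proj v {j} x = proj v {j} y" "x \<bullet> v j = y \<bullet> v j"
  shows "x = y"
  using assms by (simp add: proj_singleton)

lemma extremal_imp_upper_point:
  assumes "x \<in> frontier B" "\<forall>y\<in>frontier B. y \<bullet> v j \<le> x \<bullet> v j"
  shows "upper_point v B j (proj v {j} x) = x"
proof -
  let ?P = "\<lambda>u. u \<in> frontier B \<and> proj v {j} u = proj v {j} x"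
  have "?P (arg_max (\<lambda>u. u \<bullet> v j) ?P) \<and> x \<bullet> v j \<le> arg_max (\<lambda>u. u \<bullet> v j) ?P \<bullet> v j"
    by (rule arg_maxI[where x = x]) (use assms in \<open>auto simp: not_less\<close>)
  then show ?thesis
    unfolding upper_point_def using assms(2) proj_singleton_eq_imp_eq by (metis antisym)
qed

lemma extremal_imp_lower_point:
  assumes "x \<in> frontier B" "\<forall>y\<in>frontier B. x \<bullet> v j \<le> y \<bullet> v j"
  shows "lower_point v B j (proj v {j} x) = x"
proof -
  let ?P = "\<lambda>u. u \<in> frontier B \<and> proj v {j} u = proj v {j} x"
  have "?P (arg_min (\<lambda>u. u \<bullet> v j) ?P) \<and> arg_min (\<lambda>u. u \<bullet> v j) ?P \<bullet> v j \<le> x \<bullet> v j"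
    by (rule arg_minI[where x = x]) (use assms in \<open>auto simp: not_less\<close>)
  then show ?thesis
    unfolding lower_point_def using assms(2) proj_singleton_eq_imp_eq by (metis antisym)
qed

text \<open>A point of \<open>B\<close> projects into the boundary or into the interior of \<open>p\<^sub>j(B)\<close>. In the second case it
  must be shown to be \<open>x\<^sup>+\<close> (or \<open>x\<^sup>-\<close>) over its own projection, which holds since it is extremal even
  on all of \<open>\<partial>B\<close>.\<close>

lemma extremal_in_D_plus:
  assumes "orthonormal_basis N v" "j \<in> {1..N}" "convex B" "interior B \<noteq> {}" "compact B"
    and "x \<in> frontier B" "\<forall>y\<in>frontier B. y \<bullet> v j \<le> x \<bullet> v j"
  shows "x \<in> D_plus v B j"
proof (cases "x \<in> D_zero v B j")
  case True
  then show ?thesis by (simp add: D_plus_def)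
next
  case False
  moreover have "x \<in> B"
    using assms(5,6) compact_imp_closed frontier_subset_closed by blast
  ultimately have "proj v {j} x \<in> proj_interior v {j} B"
    using proj_interior_eq(1)[OF assms(1) _ assms(3,4), of "{j}"] assms(2)
      D_zero_eq_shadow[OF assms(1-5)] by (simp add: shadow_def)
  then have "upper_point v B j (proj v {j} x) \<in> U_plus v B j"
    by (simp add: U_plus_def)
  then show ?thesis
    using extremal_imp_upper_point[where v = v, OF assms(6,7)] by (simp add: D_plus_def)
qed

lemma extremal_in_D_minus:
  assumes "orthonormal_basis N v" "j \<in> {1..N}" "convex B" "interior B \<noteq> {}" "compact B"
    and "x \<in> frontier B" "\<forall>y\<in>frontier B. x \<bullet> v j \<le> y \<bullet> v j"
  shows "x \<in> D_minus v B j"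
proof (cases "x \<in> D_zero v B j")
  case True
  then show ?thesis by (simp add: D_minus_def)
next
  case False
  moreover have "x \<in> B"
    using assms(5,6) compact_imp_closed frontier_subset_closed by blast
  ultimately have "proj v {j} x \<in> proj_interior v {j} B"
    using proj_interior_eq(1)[OF assms(1) _ assms(3,4), of "{j}"] assms(2)
      D_zero_eq_shadow[OF assms(1-5)] by (simp add: shadow_def)
  then have "lower_point v B j (proj v {j} x) \<in> U_minus v B j"
    by (simp add: U_minus_def)
  then show ?thesis
    using extremal_imp_lower_point[where v = v, OF assms(6,7)] by (simp add: D_minus_def)
qed

section \<open>Intersections of the boundary pieces\<close>

theorem proposition1p3:
  fixes n :: nat
    and B :: "'a::euclidean_space set"
    and v :: "nat \<Rightarrow> 'a"
  assumes "n \<ge> 1"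
    and "DIM('a) = n + 1"
    and "compact B"
    and "strictly_convex B"
    and "interior B \<noteq> {}"
    and "orthonormal_basis (n + 1) v"
    and "regular_wrt n v B"
    and "\<not> (\<exists>x. special_corner n v B x)"
  shows "(\<forall>I. I \<subseteq> {1..n+1} \<and> card I \<le> n \<longrightarrow>
            top_of_set (frontier B \<inter> (\<Inter>i\<in>I. D_zero v B i)) homeomorphic_space nsphere (n - card I))
    \<and> (\<forall>j\<in>{1..n+1}. \<exists>xp xm. xp \<noteq> xm \<and> (\<Inter>i\<in>{1..n+1} - {j}. D_zero v B i) = {xp, xm} \<and>
            xp \<in> D_plus v B j \<and> xm \<in> D_minus v B j)
    \<and> (\<Inter>i\<in>{1..n+1}. D_zero v B i) = {}"
proof (intro conjI allI ballI impI)
  have conv: "convex B" by (rule strictly_convex_imp_convex[OF assms(4)])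
  note shadow_eq = Inter_D_zero_eq_shadow[OF assms(6) conv assms(5,3,7)]
  show "top_of_set (frontier B \<inter> (\<Inter>i\<in>I. D_zero v B i)) homeomorphic_space nsphere (n - card I)"
    if I: "I \<subseteq> {1..n+1} \<and> card I \<le> n" for I
  proof -
    have "card ({1..n+1} - I) = Suc (n - card I)"
      using I by (subst card_Diff_subset) (auto intro: finite_subset)
    then show ?thesis
      using I shadow_eq[of I] shadow_homeomorphic_nsphere[OF assms(6) _ _ assms(4,5,3)] by simp
  qed
  show "\<exists>xp xm. xp \<noteq> xm \<and> (\<Inter>i\<in>{1..n+1} - {j}. D_zero v B i) = {xp, xm} \<and>
            xp \<in> D_plus v B j \<and> xm \<in> D_minus v B j" if j: "j \<in> {1..n+1}" for j
  proof -
    let ?I = "{1..n+1} - {j}"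
    have "v j \<noteq> 0"
      using assms(6) j by (force simp: orthonormal_basis_def)
    with assms(3-5) obtain xp xm where x: "xp \<noteq> xm" "shadow (\<lambda>x. x \<bullet> v j) B = {xp, xm}"
        "\<forall>y\<in>B. y \<bullet> v j \<le> xp \<bullet> v j" "\<forall>y\<in>B. xm \<bullet> v j \<le> y \<bullet> v j"
      by (rule extremal_pair)
    have "card ?I \<le> n" using j by simp
    then have eq: "frontier B \<inter> (\<Inter>i\<in>?I. D_zero v B i) = {xp, xm}"
      using shadow_eq[of ?I] shadow_proj_complement[OF assms(6) j] x(2) by simp
    \<comment> \<open>Since \<open>n \<ge> 1\<close>, some \<open>D\<^sub>i\<^sup>0\<close> takes part in the intersection and keeps it inside \<open>\<partial>B\<close>.\<close>
    have "card ?I = n" using j by simp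
    then have "?I \<noteq> {}" using assms(1) by (metis card.empty not_one_le_zero)
    then obtain i where "i \<in> ?I" by blast
    then have "(\<Inter>i\<in>?I. D_zero v B i) \<subseteq> frontier B"
      using D_zero_eq_shadow[OF assms(6) _ conv assms(5,3), of i]
        shadow_subset_frontier[of "proj v {i}" B] by blast
    with eq have inter: "(\<Inter>i\<in>?I. D_zero v B i) = {xp, xm}" by blast
    have fr: "frontier B \<subseteq> B"
      using assms(3) by (simp add: compact_imp_closed frontier_subset_closed)
    have "xp \<in> D_plus v B j"
      using extremal_in_D_plus[OF assms(6) j conv assms(5,3), of xp] x(3) eq fr by blast
    moreover have "xm \<in> D_minus v B j"
      using extremal_in_D_minus[OF assms(6) j conv assms(5,3), of xm] x(4) eq fr by blast
    ultimately show ?thesis using x(1) inter by blast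
  qed
  show "(\<Inter>i\<in>{1..n+1}. D_zero v B i) = {}"
  proof (rule ccontr)
    assume "(\<Inter>i\<in>{1..n+1}. D_zero v B i) \<noteq> {}"
    then obtain x where "\<forall>i\<in>{1..n+1}. x \<in> D_zero v B i" by blast
    then have "special_corner n v B x"
      by (force simp: special_corner_def D_zero_def)
    then show False using assms(8) by blast
  qed
qed

end
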